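(* Let $d\ge 1$ be an integer. For any integer $k \geq 1$ and any real $\lambda > 0$, the limit $\lim_{t \to \infty} \overline{F}_{k,\lambda}(t)$ exists, and equals $a_{k,\lambda} := \inf_{t > 0} \overline{F}_{k,\lambda}(t)$.
   Context: For $V \subseteq \mathbb{R}^d$ and $r>0$, $G_r(V)$ is the graph with vertex set $V$ in which two distinct points $u,v\in V$ are adjacent if and only if $\|u-v\|\le r$ (Euclidean norm). For $k \in \mathbb{N}=\{1,2,\dots\}$ and finite $V$, $N_{k,r}(V)$ is the maximum number of vertices of $G_r(V)$ that can be properly colored with $k$ colors, i.e., the largest cardinality of a subset $U\subseteq V$ such that the induced subgraph $G_r(U)$ is $k$-colorable. $\mathcal{X}_\lambda$ is a Poisson point process of (constant) intensity $\lambda$ in $\mathbb{R}^d$. Set $F_{k,\lambda}(t) = N_{k,1}([0,t]^d \cap \mathcal{X}_\lambda)$, $\widetilde{F}_{k,\lambda}(t) = F_{k,\lambda}(t)/(\lambda t^d)$ and $\overline{F}_{k,\lambda}(t) = \mathbb{E}\{\widetilde{F}_{k,\lambda}(t)\}$ for $t>0$. *)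

theory Defs
  imports "HOL-Probability.Probability"
begin

type_synonym 'v graph = "'v set \<times> 'v set set"

definition geometric_graph :: "real \<Rightarrow> 'a::metric_space set \<Rightarrow> 'a graph" where
  "geometric_graph r V = (V, {{u, v} | u v. u \<in> V \<and> v \<in> V \<and> u \<noteq> v \<and> dist u v \<le> r})"

definition colorable :: "nat \<Rightarrow> 'v graph \<Rightarrow> bool" where
  "colorable k G \<longleftrightarrow>
     (\<exists>c :: 'v \<Rightarrow> nat. c ` fst G \<subseteq> {..<k} \<and> (\<forall>u v. {u, v} \<in> snd G \<longrightarrow> c u \<noteq> c v))"

text \<open>The subgraph of \<open>geometric_graph r V\<close> induced by \<open>U \<subseteq> V\<close> is \<open>geometric_graph r U\<close>.
  The definition is meant for finite \<open>V\<close> only.\<close>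

definition max_colorable :: "nat \<Rightarrow> real \<Rightarrow> 'a::metric_space set \<Rightarrow> nat" where
  "max_colorable k r V = Max (card ` {U. U \<subseteq> V \<and> colorable k (geometric_graph r U)})"

text \<open>A (simple) Poisson process is a random locally finite set, described by the numbers of its
  points in bounded Borel sets. The Poisson weights are written out because
  \<^const>\<open>poisson_pmf\<close> is unspecified for rate \<open>0\<close>, which occurs for null sets \<open>B\<close>;
  as \<open>0 ^ 0 = 1\<close>, the count is then almost surely \<open>0\<close>. Independence includes measurability of
  the counts.\<close>

locale poisson_process = prob_space M
  for M :: "'w measure" and X :: "'w \<Rightarrow> (real ^ 'd) set" and lam :: real +
  assumes locally_finite:
      "\<And>\<omega> B. \<omega> \<in> space M \<Longrightarrow> bounded B \<Longrightarrow> finite (B \<inter> X \<omega>)"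
    and count_poisson:
      "\<And>B n. B \<in> sets borel \<Longrightarrow> bounded B \<Longrightarrow>
         prob {\<omega> \<in> space M. card (B \<inter> X \<omega>) = n} =
           (lam * measure lborel B) ^ n / fact n * exp (- (lam * measure lborel B))"
    and count_indep:
      "\<And>(A :: nat \<Rightarrow> (real ^ 'd) set) I. finite I \<Longrightarrow> disjoint_family_on A I \<Longrightarrow>
         (\<And>i. i \<in> I \<Longrightarrow> A i \<in> sets borel \<and> bounded (A i)) \<Longrightarrow>
         indep_vars (\<lambda>_. count_space UNIV) (\<lambda>i \<omega>. card (A i \<inter> X \<omega>)) I"

definition cube :: "real \<Rightarrow> (real ^ 'd) set" where
  "cube t = {x. \<forall>i. x $ i \<in> {0..t}}"

definition F :: "('w \<Rightarrow> (real ^ 'd) set) \<Rightarrow> nat \<Rightarrow> real \<Rightarrow> 'w \<Rightarrow> nat" where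
  "F X k t \<omega> = max_colorable k 1 (cube t \<inter> X \<omega>)"

definition F_tilde :: "('w \<Rightarrow> (real ^ 'd) set) \<Rightarrow> nat \<Rightarrow> real \<Rightarrow> real \<Rightarrow> 'w \<Rightarrow> real" where
  "F_tilde X k lam t \<omega> = real (F X k t \<omega>) / (lam * t ^ CARD('d))"

definition F_bar ::
  "'w measure \<Rightarrow> ('w \<Rightarrow> (real ^ 'd) set) \<Rightarrow> nat \<Rightarrow> real \<Rightarrow> real \<Rightarrow> real" where
  "F_bar M X k lam t = (\<integral>\<omega>. F_tilde X k lam t \<omega> \<partial>M)"

definition a_const ::
  "'w measure \<Rightarrow> ('w \<Rightarrow> (real ^ 'd) set) \<Rightarrow> nat \<Rightarrow> real \<Rightarrow> real" where
  "a_const M X k lam = (INF t\<in>{0<..}. F_bar M X k lam t)"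

end

theory Submission
  imports Defs
begin

text \<open>A cube of side \<open>s\<close> is covered by \<open>n\<^sup>d\<close> closed translates of a cube of side \<open>t\<close> as soon
  as \<open>s < n t\<close>, and the colourable number is subadditive under covers, so translation invariance of
  its expectation gives \<open>F_bar s \<le> (1 + t / s)\<^sup>d F_bar t\<close>; let \<open>s\<close> tend to infinity and then
  take the infimum over \<open>t\<close>. For measurability and translation invariance, round the points to a
  finite grid: the colourable number of the rounded points depends only on which cells are
  occupied, and the law of the occupied cells depends only on the volumes of the cells. As the mesh
  tends to \<open>0\<close> this number is eventually the original one, and it is dominated by the number of
  points, which is integrable.\<close>

section \<open>Colourable subsets of geometric graphs\<close>

lemma colorable_geometric_graph_iff:
  "colorable k (geometric_graph r U) \<longleftrightarrow>
     (\<exists>c. c ` U \<subseteq> {..<k} \<and> (\<forall>u\<in>U. \<forall>v\<in>U. u \<noteq> v \<longrightarrow> dist u v \<le> r \<longrightarrow> c u \<noteq> c v))"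
proof -
  have "(\<forall>u v. {u, v} \<in> {{u, v} | u v. u \<in> U \<and> v \<in> U \<and> u \<noteq> v \<and> dist u v \<le> r} \<longrightarrow> c u \<noteq> c v)
    \<longleftrightarrow> (\<forall>u\<in>U. \<forall>v\<in>U. u \<noteq> v \<longrightarrow> dist u v \<le> r \<longrightarrow> c u \<noteq> c v)" for c :: "'a \<Rightarrow> nat"
  proof safe
    fix u v assume "\<forall>u v. {u, v} \<in> {{u, v} | u v. u \<in> U \<and> v \<in> U \<and> u \<noteq> v \<and> dist u v \<le> r} \<longrightarrow> c u \<noteq> c v"
      "u \<in> U" "v \<in> U" "u \<noteq> v" "dist u v \<le> r" "c u = c v"
    then show False by blast
  next
    fix u v u' v' assume "\<forall>u\<in>U. \<forall>v\<in>U. u \<noteq> v \<longrightarrow> dist u v \<le> r \<longrightarrow> c u \<noteq> c v"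
      "c u = c v" "{u, v} = {u', v'}" "u' \<in> U" "v' \<in> U" "u' \<noteq> v'" "dist u' v' \<le> r"
    then show False by (metis doubleton_eq_iff)
  qed
  then show ?thesis
    unfolding colorable_def geometric_graph_def by simp
qed

lemma colorable_geometric_graph_mono:
  assumes "colorable k (geometric_graph r U)" "W \<subseteq> U"
  shows "colorable k (geometric_graph r W)"
  using assms unfolding colorable_geometric_graph_iff by (meson image_mono order_trans subsetD)

lemma card_le_max_colorable:
  assumes "finite V" "U \<subseteq> V" "colorable k (geometric_graph r U)"
  shows "card U \<le> max_colorable k r V"
  unfolding max_colorable_def using assms by (intro Max_ge) auto

lemma max_colorable_attained:
  assumes "finite V"
  obtains U where "U \<subseteq> V" "colorable k (geometric_graph r U)" "card U = max_colorable k r V"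
proof -
  \<comment> \<open>The empty set is colourable even with no colours, so the \<open>Max\<close>
    ranges over a nonempty finite set and is attained.\<close>
  have "colorable k (geometric_graph r {})"
    by (simp add: colorable_geometric_graph_iff)
  then have "card ` {U. U \<subseteq> V \<and> colorable k (geometric_graph r U)} \<noteq> {}"
    by blast
  then have "max_colorable k r V \<in> card ` {U. U \<subseteq> V \<and> colorable k (geometric_graph r U)}"
    unfolding max_colorable_def using assms by (intro Max_in) auto
  then show ?thesis
    using that by auto
qed

lemma max_colorable_le_card:
  assumes "finite V"
  shows "max_colorable k r V \<le> card V"
  by (metis assms card_mono max_colorable_attained)

lemma max_colorable_image_ge:
  assumes "finite V" "inj_on f V"
    and edge: "\<And>u v. u \<in> V \<Longrightarrow> v \<in> V \<Longrightarrow> dist (f u) (f v) \<le> s \<Longrightarrow> dist u v \<le> r"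
  shows "max_colorable k r V \<le> max_colorable k s (f ` V)"
proof -
  obtain U where U: "U \<subseteq> V" "colorable k (geometric_graph r U)" "card U = max_colorable k r V"
    using max_colorable_attained[OF assms(1)] .
  from U(2) obtain c where c: "c ` U \<subseteq> {..<k}"
    "\<And>u v. u \<in> U \<Longrightarrow> v \<in> U \<Longrightarrow> u \<noteq> v \<Longrightarrow> dist u v \<le> r \<Longrightarrow> c u \<noteq> c v"
    unfolding colorable_geometric_graph_iff by metis
  have inj: "inj_on f U"
    using assms(2) U(1) by (rule inj_on_subset)
  have "colorable k (geometric_graph s (f ` U))"
    unfolding colorable_geometric_graph_iff
  proof (intro exI[of _ "c \<circ> inv_into U f"] conjI)
    show "(c \<circ> inv_into U f) ` f ` U \<subseteq> {..<k}"
      using c(1) inj by auto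
    have "c u \<noteq> c v" if "u \<in> U" "v \<in> U" "f u \<noteq> f v" "dist (f u) (f v) \<le> s" for u v
      using that U(1) edge[of u v] by (intro c(2)) auto
    then show "\<forall>x\<in>f ` U. \<forall>y\<in>f ` U. x \<noteq> y \<longrightarrow> dist x y \<le> s \<longrightarrow>
        (c \<circ> inv_into U f) x \<noteq> (c \<circ> inv_into U f) y"
      using inj by simp
  qed
  then have "card (f ` U) \<le> max_colorable k s (f ` V)"
    using assms(1) U(1) by (intro card_le_max_colorable) auto
  then show ?thesis
    using U(3) inj by (simp add: card_image)
qed

lemma max_colorable_image:
  assumes "finite V" "inj_on f V"
    and edge: "\<And>u v. u \<in> V \<Longrightarrow> v \<in> V \<Longrightarrow> dist (f u) (f v) \<le> s \<longleftrightarrow> dist u v \<le> r"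
  shows "max_colorable k s (f ` V) = max_colorable k r V"
proof (rule antisym)
  \<comment> \<open>The reverse inequality is the same lemma applied to the inverse map, since the
    equivalence \<open>edge\<close> can be read in both directions.\<close>
  have "max_colorable k s (f ` V) \<le> max_colorable k r (inv_into V f ` f ` V)"
    using assms by (intro max_colorable_image_ge) (auto simp: inj_on_inv_into)
  then show "max_colorable k s (f ` V) \<le> max_colorable k r V"
    using assms(2) by simp
qed (use assms in \<open>auto intro: max_colorable_image_ge\<close>)

text \<open>An optimal \<open>U\<close> in \<open>W\<close> leaves a colourable trace on every
  \<open>V j\<close>. The pieces may overlap, since overlaps only enlarge the sum.\<close>

lemma max_colorable_cover_le:
  assumes "finite J" "\<And>j. j \<in> J \<Longrightarrow> finite (V j)" "W \<subseteq> (\<Union>j\<in>J. V j)"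
  shows "max_colorable k r W \<le> (\<Sum>j\<in>J. max_colorable k r (V j))"
proof -
  have "finite W"
    using assms by (meson finite_UN_I finite_subset)
  then obtain U where U: "U \<subseteq> W" "colorable k (geometric_graph r U)" "card U = max_colorable k r W"
    using max_colorable_attained by blast
  have "U = (\<Union>j\<in>J. U \<inter> V j)"
    using U(1) assms(3) by blast
  then have "card U \<le> (\<Sum>j\<in>J. card (U \<inter> V j))"
    using card_UN_le[OF assms(1)] by metis
  also have "\<dots> \<le> (\<Sum>j\<in>J. max_colorable k r (V j))"
    using assms(2) colorable_geometric_graph_mono[OF U(2)]
    by (intro sum_mono card_le_max_colorable) auto
  finally show ?thesis
    using U(3) by simp
qed

section \<open>Rounding to a finite grid\<close>

text \<open>The fibres are half-open cubes of side \<open>1 / Suc n\<close>, hence disjoint Borel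
  cells; \<open>Suc\<close> keeps the mesh size meaningful at \<open>n = 0\<close>.\<close>

definition grid :: "nat \<Rightarrow> real ^ 'd \<Rightarrow> real ^ 'd" where
  "grid n x = (\<chi> i. of_int \<lfloor>real (Suc n) * x $ i\<rfloor> / real (Suc n))"

text \<open>Every coordinate moves by at most one mesh width, and the Euclidean norm is at most the
  sum norm. This crude bound is enough, as only its convergence to 0 matters.\<close>

lemma dist_grid_le: "dist (grid n x) (x :: real ^ 'd) \<le> real CARD('d) / real (Suc n)"
proof -
  have "\<bar>(grid n x - x) $ i\<bar> \<le> 1 / real (Suc n)" for i
  proof -
    have "(grid n x - x) $ i = (of_int \<lfloor>real (Suc n) * x $ i\<rfloor> - real (Suc n) * x $ i) / real (Suc n)"
      by (simp add: grid_def field_simps)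
    moreover have "\<bar>of_int \<lfloor>real (Suc n) * x $ i\<rfloor> - real (Suc n) * x $ i\<bar> \<le> 1"
      by linarith
    ultimately show ?thesis
      by (simp add: divide_right_mono del: of_nat_Suc)
  qed
  then have "(\<Sum>i\<in>UNIV. \<bar>(grid n x - x) $ i\<bar>) \<le> (\<Sum>i\<in>(UNIV :: 'd set). 1 / real (Suc n))"
    by (intro sum_mono)
  then show ?thesis
    unfolding dist_norm using norm_le_l1_cart[of "grid n x - x"] by simp
qed

lemma finite_grid_image:
  assumes "bounded (A :: (real ^ 'd) set)"
  shows "finite (grid n ` A)"
proof -
  obtain b where b: "\<And>x. x \<in> A \<Longrightarrow> norm x \<le> b"
    using assms bounded_iff by blast
  define z where "z = \<lceil>real (Suc n) * b\<rceil>"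
  define G where "G = (\<lambda>j :: 'd \<Rightarrow> int. \<chi> i. of_int (j i) / real (Suc n)) ` (UNIV \<rightarrow>\<^sub>E {-z-1..z})"
  have "finite G"
    unfolding G_def by (intro finite_imageI finite_PiE) auto
  moreover have "grid n ` A \<subseteq> G"
  proof
    fix p assume "p \<in> grid n ` A"
    then obtain x where x: "x \<in> A" "p = grid n x" by blast
    have "\<lfloor>real (Suc n) * x $ i\<rfloor> \<in> {-z-1..z}" for i
    proof -
      have "\<bar>x $ i\<bar> \<le> b"
        using component_le_norm_cart[of x i] b[OF x(1)] by linarith
      then have "\<bar>real (Suc n) * x $ i\<bar> \<le> real (Suc n) * b"
        unfolding abs_mult by (simp add: mult_left_mono del: of_nat_Suc)
      then show ?thesis
        unfolding z_def atLeastAtMost_iff by linarith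
    qed
    then show "p \<in> G"
      unfolding G_def x(2) grid_def by (intro image_eqI[of _ _ "\<lambda>i. \<lfloor>real (Suc n) * x $ i\<rfloor>"]) auto
  qed
  ultimately show ?thesis
    by (rule finite_subset[rotated])
qed

lemma grid_fibre_borel:
  assumes "A \<in> sets borel"
  shows "{x \<in> A. grid n x = p} \<in> sets borel"
proof -
  have "{x \<in> A. grid n x = p} =
      A \<inter> {x \<in> space borel. \<forall>i. of_int \<lfloor>real (Suc n) * x $ i\<rfloor> / real (Suc n) = p $ i}"
    by (auto simp: grid_def vec_eq_iff)
  also have "\<dots> \<in> sets borel"
    using assms by measurable
  finally show ?thesis .
qed

text \<open>Enlarging the threshold keeps the adjacencies under rounding, and non-adjacency is an open
  condition, so rounding on a fine enough grid is a graph isomorphism.\<close>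

lemma eventually_max_colorable_grid:
  fixes V :: "(real ^ 'd) set"
  assumes "finite V"
  shows "\<forall>\<^sub>F n in sequentially.
    max_colorable k (r + 2 * (real CARD('d) / real (Suc n))) (grid n ` V) = max_colorable k r V"
proof -
  define e where "e n = real CARD('d) / real (Suc n)" for n
  have e: "e \<longlonglongrightarrow> 0"
    unfolding e_def using LIMSEQ_Suc[OF lim_const_over_n[of "real CARD('d)"]] by simp
  \<comment> \<open>Rounding changes a distance by at most \<open>2 * e n\<close>. The first clause
    therefore keeps distinct points distinct; by the second, a pair further apart than
    \<open>r\<close> stays beyond the enlarged threshold, because
    \<open>r + 4 * e n - 2 * e n = r + 2 * e n\<close>.\<close>
  have "\<forall>\<^sub>F n in sequentially. \<forall>u\<in>V. \<forall>v\<in>V.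
      (u \<noteq> v \<longrightarrow> 2 * e n < dist u v) \<and> (r < dist u v \<longrightarrow> r + 4 * e n < dist u v)"
  proof (intro eventually_ball_finite ballI assms eventually_conj)
    fix u v
    have *: "\<forall>\<^sub>F n in sequentially. e n < c" if "0 < c" for c
      using order_tendstoD(2)[OF e that] .
    show "\<forall>\<^sub>F n in sequentially. u \<noteq> v \<longrightarrow> 2 * e n < dist u v"
      using *[of "dist u v / 2"] by (cases "u = v") (auto elim: eventually_mono)
    show "\<forall>\<^sub>F n in sequentially. r < dist u v \<longrightarrow> r + 4 * e n < dist u v"
      using *[of "(dist u v - r) / 4"] by (cases "r < dist u v") (auto elim!: eventually_mono)
  qed
  then show ?thesis
  proof (rule eventually_mono)
    fix n assume n: "\<forall>u\<in>V. \<forall>v\<in>V.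
      (u \<noteq> v \<longrightarrow> 2 * e n < dist u v) \<and> (r < dist u v \<longrightarrow> r + 4 * e n < dist u v)"
    have d: "\<bar>dist (grid n u) (grid n v) - dist u v\<bar> \<le> 2 * e n" for u v :: "real ^ 'd"
      using dist_grid_le[of n u] dist_grid_le[of n v] unfolding e_def
      by (smt (verit) dist_commute dist_triangle)
    have "max_colorable k (r + 2 * e n) (grid n ` V) = max_colorable k r V"
    proof (rule max_colorable_image[OF assms])
      show "inj_on (grid n) V"
      proof (rule inj_onI, rule ccontr)
        fix u v assume "u \<in> V" "v \<in> V" "grid n u = grid n v" "u \<noteq> v"
        then show False
          using n d[of u v] by force
      qed
      fix u v assume "u \<in> V" "v \<in> V"
      then show "dist (grid n u) (grid n v) \<le> r + 2 * e n \<longleftrightarrow> dist u v \<le> r"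
        using n d[of u v] by (smt (verit))
    qed
    then show "max_colorable k (r + 2 * (real CARD('d) / real (Suc n))) (grid n ` V) = max_colorable k r V"
      unfolding e_def .
  qed
qed

section \<open>Expectations under the Poisson process: counts, occupied cells, translation
  invariance\<close>

lemma translation_borel:
  fixes A :: "(real ^ 'd) set"
  assumes "A \<in> sets borel"
  shows "(+) a ` A \<in> sets borel"
proof -
  have "(+) a ` A = (\<lambda>x. x - a) -` A \<inter> space borel"
    by (auto intro!: image_eqI[of _ "(+) a" "x - a" for x])
  also have "\<dots> \<in> sets borel"
    using assms by measurable
  finally show ?thesis .
qed

context poisson_process
begin

text \<open>The locale provides measurability only as a part of independence, so it is extracted
  from a one-element family.\<close>

lemma count_measurable:
  assumes "B \<in> sets borel" "bounded B"
  shows "(\<lambda>\<omega>. card (B \<inter> X \<omega>)) \<in> measurable M (count_space UNIV)"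
proof -
  have "indep_vars (\<lambda>_. count_space UNIV) (\<lambda>i \<omega>. card (B \<inter> X \<omega>)) {0 :: nat}"
    using assms by (intro count_indep) (auto simp: disjoint_family_on_def)
  then show ?thesis
    by (simp add: indep_vars_def2)
qed

text \<open>Finiteness of the mean suffices: the count is the sum over \<open>n\<close> of
  \<open>n\<close> times the indicator that it equals \<open>n\<close>, and the resulting series of
  Poisson weights converges. This provides the dominating function later on.\<close>

lemma count_integrable:
  assumes "B \<in> sets borel" "bounded B"
  shows "integrable M (\<lambda>\<omega>. real (card (B \<inter> X \<omega>)))"
proof (rule integrableI_bounded)
  note [measurable] = count_measurable[OF assms]
  show "(\<lambda>\<omega>. real (card (B \<inter> X \<omega>))) \<in> borel_measurable M"
    by measurable
  define x where "x = lam * measure lborel B"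
  have "(\<lambda>n. x ^ n / fact n) sums exp x"
    using exp_converges[of x] by (simp add: divide_inverse mult.commute)
  then have "summable (\<lambda>n. x * (x ^ n / fact n) * exp (- x))"
    by (intro summable_mult2 summable_mult) (rule sums_summable)
  \<comment> \<open>The factor \<open>Suc n\<close> cancels against the factorial, so the shifted
    series for the mean is \<open>x\<close> times the exponential series.\<close>
  moreover have "x * (x ^ n / fact n) = real (Suc n) * (x ^ Suc n / fact (Suc n))" for n
    by (simp add: fact_Suc del: of_nat_Suc)
  ultimately have "summable (\<lambda>n. real (Suc n) * (x ^ Suc n / fact (Suc n) * exp (- x)))"
    by (simp add: mult.assoc)
  then have "summable (\<lambda>n. real n * (x ^ n / fact n * exp (- x)))"
    by (subst summable_Suc_iff[symmetric])
  then have summable: "summable (\<lambda>n. real n * prob {\<omega> \<in> space M. card (B \<inter> X \<omega>) = n})"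
    by (simp add: count_poisson[OF assms] x_def)
  have "(\<integral>\<^sup>+\<omega>. ennreal (norm (real (card (B \<inter> X \<omega>)))) \<partial>M) =
      (\<integral>\<^sup>+\<omega>. (\<Sum>n. ennreal (real n) * indicator {\<omega> \<in> space M. card (B \<inter> X \<omega>) = n} \<omega>) \<partial>M)"
  proof (rule nn_integral_cong)
    fix \<omega> assume w: "\<omega> \<in> space M"
    have "(\<Sum>n. ennreal (real n) * indicator {\<omega> \<in> space M. card (B \<inter> X \<omega>) = n} \<omega>) =
        (\<Sum>n\<in>{card (B \<inter> X \<omega>)}. ennreal (real n) * indicator {\<omega> \<in> space M. card (B \<inter> X \<omega>) = n} \<omega>)"
      by (rule suminf_finite) (auto simp: indicator_def)
    then show "ennreal (norm (real (card (B \<inter> X \<omega>)))) =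
        (\<Sum>n. ennreal (real n) * indicator {\<omega> \<in> space M. card (B \<inter> X \<omega>) = n} \<omega>)"
      using w by (simp add: indicator_def)
  qed
  also have "\<dots> = (\<Sum>n. \<integral>\<^sup>+\<omega>. ennreal (real n) * indicator {\<omega> \<in> space M. card (B \<inter> X \<omega>) = n} \<omega> \<partial>M)"
    by (rule nn_integral_suminf) measurable
  also have "\<dots> = (\<Sum>n. ennreal (real n * prob {\<omega> \<in> space M. card (B \<inter> X \<omega>) = n}))"
    by (simp add: nn_integral_cmult_indicator emeasure_eq_measure ennreal_mult)
  also have "\<dots> < \<infinity>"
    by (subst suminf_ennreal2[OF _ summable]) (simp_all add: less_top[symmetric])
  finally show "(\<integral>\<^sup>+\<omega>. ennreal (norm (real (card (B \<inter> X \<omega>)))) \<partial>M) < \<infinity>" .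
qed

text \<open>Counts in disjoint cells are independent and a cell is empty with probability
  \<open>exp (- (lam * measure lborel (A p)))\<close>, so the probability of an occupancy pattern is
  a product over the cells.\<close>

lemma occupancy_prob:
  fixes A :: "'b \<Rightarrow> (real ^ 'd) set"
  assumes "finite P" "disjoint_family_on A P" "S \<subseteq> P"
    and A: "\<And>p. p \<in> P \<Longrightarrow> A p \<in> sets borel" "\<And>p. p \<in> P \<Longrightarrow> bounded (A p)"
  shows "{\<omega> \<in> space M. {p \<in> P. A p \<inter> X \<omega> \<noteq> {}} = S} \<in> events" (is "?E \<in> _")
    and "prob {\<omega> \<in> space M. {p \<in> P. A p \<inter> X \<omega> \<noteq> {}} = S} =
      (\<Prod>p\<in>P. if p \<in> S then 1 - exp (- (lam * measure lborel (A p)))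
        else exp (- (lam * measure lborel (A p))))"
proof -
  \<comment> \<open>\<open>T p\<close> holds the counts that the pattern \<open>S\<close> admits in
    cell \<open>p\<close>. As \<open>card\<close> is 0 on infinite sets too, local finiteness is
    what makes count 0 mean an empty cell.\<close>
  define T :: "'b \<Rightarrow> nat set" where "T p = (if p \<in> S then - {0} else {0})" for p
  have E: "?E = {\<omega> \<in> space M. \<forall>p\<in>P. card (A p \<inter> X \<omega>) \<in> T p}"
  proof (rule Collect_cong, rule conj_cong)
    fix \<omega> assume "\<omega> \<in> space M"
    then have "card (A p \<inter> X \<omega>) \<in> T p \<longleftrightarrow> (A p \<inter> X \<omega> \<noteq> {} \<longleftrightarrow> p \<in> S)" if "p \<in> P" for p
      using locally_finite A(2)[OF that] by (auto simp: T_def)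
    then show "{p \<in> P. A p \<inter> X \<omega> \<noteq> {}} = S \<longleftrightarrow> (\<forall>p\<in>P. card (A p \<inter> X \<omega>) \<in> T p)"
      using assms(3) by blast
  qed simp
  have meas: "(\<lambda>\<omega>. card (A p \<inter> X \<omega>)) \<in> measurable M (count_space UNIV)" if "p \<in> P" for p
    using count_measurable A that by blast
  show "?E \<in> events"
    unfolding E using assms(1) meas
    by (intro sets.sets_Collect_finite_All) (auto intro!: measurable_sets_Collect[where N="count_space UNIV"])
  show "prob ?E = (\<Prod>p\<in>P. if p \<in> S then 1 - exp (- (lam * measure lborel (A p)))
        else exp (- (lam * measure lborel (A p))))"
  \<comment> \<open>An intersection over no cells would be \<open>UNIV\<close> instead of the sample
    space, so this case is treated apart: the event is certain and the product is empty.\<close>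
  proof (cases "P = {}")
    case True
    then show ?thesis
      using assms(3) by (simp add: prob_space)
  next
    case False
    \<comment> \<open>\<open>count_indep\<close> speaks of families indexed by natural numbers, so
      the cells are enumerated.\<close>
    obtain g where g: "bij_betw g {..<card P} P"
      using ex_bij_betw_nat_finite[OF assms(1)] by (auto simp: atLeast0LessThan)
    then have gP: "g ` {..<card P} = P" and inj: "inj_on g {..<card P}"
      by (auto simp: bij_betw_def)
    have "indep_vars (\<lambda>_. count_space UNIV) (\<lambda>i \<omega>. card (A (g i) \<inter> X \<omega>)) {..<card P}"
    proof (rule count_indep)
      show "disjoint_family_on (\<lambda>i. A (g i)) {..<card P}"
        using assms(2) gP inj unfolding disjoint_family_on_def inj_on_def by blast
    qed (use A gP in auto)
    then have "prob (\<Inter>i\<in>{..<card P}. (\<lambda>\<omega>. card (A (g i) \<inter> X \<omega>)) -` T (g i) \<inter> space M) =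
        (\<Prod>i\<in>{..<card P}. prob ((\<lambda>\<omega>. card (A (g i) \<inter> X \<omega>)) -` T (g i) \<inter> space M))"
      using False assms(1) by (intro indep_varsD) (auto simp: lessThan_empty_iff)
    also have "(\<Inter>i\<in>{..<card P}. (\<lambda>\<omega>. card (A (g i) \<inter> X \<omega>)) -` T (g i) \<inter> space M) =
        (\<Inter>p\<in>P. (\<lambda>\<omega>. card (A p \<inter> X \<omega>)) -` T p \<inter> space M)"
      by (subst (2) gP[symmetric]) simp
    also have "\<dots> = ?E"
      unfolding E using False by auto
    also have "(\<Prod>i\<in>{..<card P}. prob ((\<lambda>\<omega>. card (A (g i) \<inter> X \<omega>)) -` T (g i) \<inter> space M)) =
        (\<Prod>p\<in>P. prob ((\<lambda>\<omega>. card (A p \<inter> X \<omega>)) -` T p \<inter> space M))"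
      by (rule prod.reindex_bij_betw[OF g])
    also have "\<dots> = (\<Prod>p\<in>P. if p \<in> S then 1 - exp (- (lam * measure lborel (A p)))
        else exp (- (lam * measure lborel (A p))))"
    proof (rule prod.cong)
      fix p assume p: "p \<in> P"
      let ?Z = "{\<omega> \<in> space M. card (A p \<inter> X \<omega>) = 0}"
      have Z: "prob ?Z = exp (- (lam * measure lborel (A p)))"
        using count_poisson[OF A(1)[OF p] A(2)[OF p], of 0] by simp
      have ev: "?Z \<in> events"
        using meas[OF p] by measurable
      show "prob ((\<lambda>\<omega>. card (A p \<inter> X \<omega>)) -` T p \<inter> space M) =
        (if p \<in> S then 1 - exp (- (lam * measure lborel (A p)))
          else exp (- (lam * measure lborel (A p))))"
      proof (cases "p \<in> S")
        case True
        then have "(\<lambda>\<omega>. card (A p \<inter> X \<omega>)) -` T p \<inter> space M = space M - ?Z"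
          by (auto simp: T_def)
        then show ?thesis
          using True Z prob_compl[OF ev] by simp
      next
        case False
        then have "(\<lambda>\<omega>. card (A p \<inter> X \<omega>)) -` T p \<inter> space M = ?Z"
          by (auto simp: T_def)
        then show ?thesis
          using False Z by simp
      qed
    qed simp
    finally show ?thesis .
  qed
qed

text \<open>There are finitely many occupancy patterns, so the integrand is a finite combination of
  indicators. On the right the cells enter through their volumes alone, which is the source of
  translation invariance.\<close>

lemma occupancy_integral:
  fixes A :: "'b \<Rightarrow> (real ^ 'd) set" and h :: "'b set \<Rightarrow> real"
  assumes "finite P" "disjoint_family_on A P"
    and A: "\<And>p. p \<in> P \<Longrightarrow> A p \<in> sets borel" "\<And>p. p \<in> P \<Longrightarrow> bounded (A p)"
  shows "(\<lambda>\<omega>. h {p \<in> P. A p \<inter> X \<omega> \<noteq> {}}) \<in> borel_measurable M"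
    and "(\<integral>\<omega>. h {p \<in> P. A p \<inter> X \<omega> \<noteq> {}} \<partial>M) =
      (\<Sum>S\<in>Pow P. h S * (\<Prod>p\<in>P. if p \<in> S then 1 - exp (- (lam * measure lborel (A p)))
        else exp (- (lam * measure lborel (A p)))))"
proof -
  define E where "E S = {\<omega> \<in> space M. {p \<in> P. A p \<inter> X \<omega> \<noteq> {}} = S}" for S
  note occ = occupancy_prob[OF assms(1,2) _ A, folded E_def]
  have eq: "h {p \<in> P. A p \<inter> X \<omega> \<noteq> {}} = (\<Sum>S\<in>Pow P. h S * indicator (E S) \<omega>)"
    if "\<omega> \<in> space M" for \<omega>
  proof -
    have "(\<Sum>S\<in>Pow P. h S * indicator (E S) \<omega>) =
        (\<Sum>S\<in>{{p \<in> P. A p \<inter> X \<omega> \<noteq> {}}}. h S * indicator (E S) \<omega>)"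
      using assms(1) by (intro sum.mono_neutral_right ballI) (auto simp: E_def indicator_def)
    then show ?thesis
      using that by (simp add: E_def)
  qed
  have "(\<lambda>\<omega>. \<Sum>S\<in>Pow P. h S * indicator (E S) \<omega>) \<in> borel_measurable M"
    using occ(1) by (intro borel_measurable_sum borel_measurable_times borel_measurable_indicator) auto
  then show "(\<lambda>\<omega>. h {p \<in> P. A p \<inter> X \<omega> \<noteq> {}}) \<in> borel_measurable M"
    by (subst measurable_cong[OF eq])
  have "(\<integral>\<omega>. h {p \<in> P. A p \<inter> X \<omega> \<noteq> {}} \<partial>M) = (\<integral>\<omega>. (\<Sum>S\<in>Pow P. h S * indicator (E S) \<omega>) \<partial>M)"
    by (rule Bochner_Integration.integral_cong[OF refl eq])
  also have "\<dots> = (\<Sum>S\<in>Pow P. \<integral>\<omega>. h S * indicator (E S) \<omega> \<partial>M)"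
    using occ(1) by (intro Bochner_Integration.integral_sum)
      (auto intro!: integrable_mult_right integrable_real_indicator simp: emeasure_eq_measure)
  also have "\<dots> = (\<Sum>S\<in>Pow P. h S * prob (E S))"
    by (intro sum.cong refl) (auto simp: E_def Int_def intro!: arg_cong[where f=prob])
  also have "\<dots> = (\<Sum>S\<in>Pow P. h S * (\<Prod>p\<in>P. if p \<in> S then 1 - exp (- (lam * measure lborel (A p)))
        else exp (- (lam * measure lborel (A p)))))"
    by (intro sum.cong refl) (simp add: occ(2))
  finally show "(\<integral>\<omega>. h {p \<in> P. A p \<inter> X \<omega> \<noteq> {}} \<partial>M) =
      (\<Sum>S\<in>Pow P. h S * (\<Prod>p\<in>P. if p \<in> S then 1 - exp (- (lam * measure lborel (A p)))
        else exp (- (lam * measure lborel (A p)))))" .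
qed

lemma max_colorable_integrable:
  assumes "A \<in> sets borel" "bounded A"
  shows "integrable M (\<lambda>\<omega>. real (max_colorable k r (A \<inter> X \<omega>)))"
  and max_colorable_integral_translation:
    "(\<integral>\<omega>. real (max_colorable k r ((+) a ` A \<inter> X \<omega>)) \<partial>M) =
      (\<integral>\<omega>. real (max_colorable k r (A \<inter> X \<omega>)) \<partial>M)"
proof -
  define e where "e n = real CARD('d) / real (Suc n)" for n
  define C where "C n p = {x \<in> A. grid n x = p}" for n p
  define h where "h n S = real (max_colorable k (r + 2 * e n) S)" for n and S :: "(real ^ 'd) set"
  \<comment> \<open>The expectation of the rounded number, written with the untranslated cells. It
    does not involve the shift \<open>a\<close>, so the limit of \<open>I\<close> is the integral
    for every shift at once.\<close>
  define I where "I n = (\<Sum>S\<in>Pow (grid n ` A). h n S * (\<Prod>p\<in>grid n ` A.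
      if p \<in> S then 1 - exp (- (lam * measure lborel (C n p)))
      else exp (- (lam * measure lborel (C n p)))))" for n
  have main: "integrable M (\<lambda>\<omega>. real (max_colorable k r ((+) a ` A \<inter> X \<omega>))) \<and>
      I \<longlonglongrightarrow> (\<integral>\<omega>. real (max_colorable k r ((+) a ` A \<inter> X \<omega>)) \<partial>M)" for a
  proof -
    define Y where "Y \<omega> = (\<lambda>x. x - a) ` ((+) a ` A \<inter> X \<omega>)" for \<omega>
    define O' where "O' n \<omega> = {p \<in> grid n ` A. (+) a ` C n p \<inter> X \<omega> \<noteq> {}}" for n \<omega>
    have aA: "(+) a ` A \<in> sets borel" "bounded ((+) a ` A)"
      using assms by (auto intro: translation_borel bounded_translation)
    have fin: "finite ((+) a ` A \<inter> X \<omega>)" if "\<omega> \<in> space M" for \<omega>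
      using locally_finite aA(2) that by blast
    have O': "O' n \<omega> = grid n ` Y \<omega>" for n \<omega>
      proof (intro equalityI subsetI)
      fix p assume "p \<in> O' n \<omega>"
      then obtain x where "x \<in> A" "grid n x = p" "a + x \<in> X \<omega>"
        by (auto simp: O'_def C_def)
      then show "p \<in> grid n ` Y \<omega>"
        unfolding Y_def by (intro image_eqI[of _ _ x] image_eqI[of _ _ "a + x"]) auto
    next
      fix p assume "p \<in> grid n ` Y \<omega>"
      then obtain x where "x \<in> A" "p = grid n x" "a + x \<in> X \<omega>"
        by (auto simp: Y_def)
      then show "p \<in> O' n \<omega>"
        unfolding O'_def C_def by blast
    qed
    have Y: "max_colorable k r (Y \<omega>) = max_colorable k r ((+) a ` A \<inter> X \<omega>)" if "\<omega> \<in> space M" for \<omega>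
      unfolding Y_def by (rule max_colorable_image) (auto simp: fin[OF that] inj_on_def dist_norm)
    have cells: "finite (grid n ` A)" "disjoint_family_on (\<lambda>p. (+) a ` C n p) (grid n ` A)"
      "(+) a ` C n p \<in> sets borel" "bounded ((+) a ` C n p)" for n p
    proof -
      show "finite (grid n ` A)"
        using assms(2) by (rule finite_grid_image)
      show "disjoint_family_on (\<lambda>p. (+) a ` C n p) (grid n ` A)"
        by (auto simp: disjoint_family_on_def C_def)
      show "(+) a ` C n p \<in> sets borel"
        unfolding C_def using assms(1) by (intro translation_borel grid_fibre_borel)
      show "bounded ((+) a ` C n p)"
        by (rule bounded_subset[OF aA(2)]) (auto simp: C_def)
    qed
    have vol: "measure lborel ((+) a ` C n p) = measure lborel (C n p)" for n p
      using measure_translation[of a "C n p"] cells(3)[of n p] grid_fibre_borel[OF assms(1), of n p]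
      by (simp add: C_def)
    have meas: "(\<lambda>\<omega>. h n (O' n \<omega>)) \<in> borel_measurable M" for n
      unfolding O'_def by (intro occupancy_integral(1) cells)
    have int: "(\<integral>\<omega>. h n (O' n \<omega>) \<partial>M) = I n" for n
      unfolding O'_def I_def vol[symmetric] by (intro occupancy_integral(2) cells)
    have lim: "(\<lambda>n. h n (O' n \<omega>)) \<longlonglongrightarrow> real (max_colorable k r ((+) a ` A \<inter> X \<omega>))"
      if "\<omega> \<in> space M" for \<omega>
    proof (rule tendsto_eventually)
      have "finite (Y \<omega>)"
        unfolding Y_def using fin[OF that] by simp
      from eventually_max_colorable_grid[OF this]
      show "\<forall>\<^sub>F n in sequentially. h n (O' n \<omega>) = real (max_colorable k r ((+) a ` A \<inter> X \<omega>))"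
        unfolding O' h_def e_def Y[OF that, symmetric] by (auto elim: eventually_mono)
    qed
    \<comment> \<open>Rounding may merge points but never adds any, so the number of points
      dominates uniformly in \<open>n\<close>.\<close>
    have bound: "norm (h n (O' n \<omega>)) \<le> real (card ((+) a ` A \<inter> X \<omega>))" if "\<omega> \<in> space M" for n \<omega>
    proof -
      have "max_colorable k (r + 2 * e n) (O' n \<omega>) \<le> card (O' n \<omega>)"
        using fin[OF that] unfolding O' Y_def by (intro max_colorable_le_card) auto
      also have "\<dots> \<le> card ((+) a ` A \<inter> X \<omega>)"
        unfolding O' Y_def image_image by (rule card_image_le[OF fin[OF that]])
      finally show ?thesis
        by (simp add: h_def)
    qed
    \<comment> \<open>Measurability of the colourable number itself comes from here: it is a
      pointwise limit of measurable functions of the finitely many occupied cells.\<close>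
    have lim_meas: "(\<lambda>\<omega>. real (max_colorable k r ((+) a ` A \<inter> X \<omega>))) \<in> borel_measurable M"
      using lim meas by (rule borel_measurable_LIMSEQ_real)
    note dom = lim_meas meas count_integrable[OF aA] AE_I2[OF lim] AE_I2[OF bound]
    show ?thesis
      using integrable_dominated_convergence[OF dom] integral_dominated_convergence[OF dom]
      unfolding int by blast
  qed
  show "integrable M (\<lambda>\<omega>. real (max_colorable k r (A \<inter> X \<omega>)))"
    using main[of 0] by simp
  show "(\<integral>\<omega>. real (max_colorable k r ((+) a ` A \<inter> X \<omega>)) \<partial>M) =
      (\<integral>\<omega>. real (max_colorable k r (A \<inter> X \<omega>)) \<partial>M)"
    \<comment> \<open>Shift \<open>a\<close> and shift 0 give two limits of the same sequence
      \<open>I\<close>.\<close>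
    using LIMSEQ_unique[of I] main[of a] main[of 0] by simp
qed

end

section \<open>Covering a large cube by translates of a small one\<close>

lemma cube_eq_cbox: "cube t = cbox 0 (\<chi> i. t)"
  by (auto simp: cube_def mem_box_cart)

lemma cube_cover:
  fixes s t :: real
  assumes "0 < t" "s < real n * t"
  shows "(cube s :: (real ^ 'd) set) \<subseteq>
    (\<Union>j\<in>UNIV \<rightarrow>\<^sub>E {..<n}. (+) (\<chi> i. t * real (j i)) ` cube t)"
proof
  fix x :: "real ^ 'd" assume x: "x \<in> cube s"
  \<comment> \<open>The index of the translate containing \<open>x\<close>. The strict inequality
    \<open>s < real n * t\<close> keeps it below \<open>n\<close> even on the far face, where a
    coordinate equals \<open>s\<close>.\<close>
  define j where "j i = nat \<lfloor>x $ i / t\<rfloor>" for i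
  have j: "j i < n" "t * real (j i) \<le> x $ i" "x $ i \<le> t * real (j i) + t" for i
  proof -
    have xi: "0 \<le> x $ i / t" "x $ i / t < real n"
      using x assms by (auto simp: cube_def field_simps intro: le_less_trans)
    then have "real (j i) \<le> x $ i / t" "x $ i / t \<le> real (j i) + 1"
      unfolding j_def by linarith+
    then show "t * real (j i) \<le> x $ i" "x $ i \<le> t * real (j i) + t"
      using assms(1) by (simp_all add: field_simps)
    show "j i < n"
      using xi \<open>real (j i) \<le> x $ i / t\<close> by linarith
  qed
  have "x - (\<chi> i. t * real (j i)) \<in> cube t"
    using j by (simp add: cube_def algebra_simps)
  then have "x \<in> (+) (\<chi> i. t * real (j i)) ` cube t"
    by (metis (no_types, lifting) diff_add_cancel add.commute image_eqI)
  moreover have "j \<in> UNIV \<rightarrow>\<^sub>E {..<n}"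
    using j(1) by auto
  ultimately show "x \<in> (\<Union>j\<in>UNIV \<rightarrow>\<^sub>E {..<n}. (+) (\<chi> i. t * real (j i)) ` cube t)"
    by blast
qed

context poisson_process
begin

lemma integral_F_le:
  assumes "0 < t" "s < real n * t"
  shows "(\<integral>\<omega>. real (F X k s \<omega>) \<partial>M) \<le> real n ^ CARD('d) * (\<integral>\<omega>. real (F X k t \<omega>) \<partial>M)"
proof -
  define J where "J = (UNIV :: 'd set) \<rightarrow>\<^sub>E {..<n}"
  define Q :: "('d \<Rightarrow> nat) \<Rightarrow> (real ^ 'd) set" where "Q j = (+) (\<chi> i. t * real (j i)) ` cube t" for j
  have J: "finite J" "card J = n ^ CARD('d)"
    unfolding J_def by (auto intro!: finite_PiE simp: card_PiE)
  have cube: "cube u \<in> sets borel" "bounded (cube u :: (real ^ 'd) set)" for u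
    by (auto simp: cube_eq_cbox)
  have Q: "Q j \<in> sets borel" "bounded (Q j)" for j
    unfolding Q_def using cube by (auto intro: translation_borel bounded_translation)
  have "(\<integral>\<omega>. real (F X k s \<omega>) \<partial>M) \<le> (\<integral>\<omega>. (\<Sum>j\<in>J. real (max_colorable k 1 (Q j \<inter> X \<omega>))) \<partial>M)"
  proof (rule integral_mono)
    fix \<omega> assume "\<omega> \<in> space M"
    then have "max_colorable k 1 (cube s \<inter> X \<omega>) \<le> (\<Sum>j\<in>J. max_colorable k 1 (Q j \<inter> X \<omega>))"
      using J(1) Q(2) locally_finite cube_cover[OF assms, where 'd='d, folded J_def Q_def]
      by (intro max_colorable_cover_le) auto
    then show "real (F X k s \<omega>) \<le> (\<Sum>j\<in>J. real (max_colorable k 1 (Q j \<inter> X \<omega>)))"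
      unfolding F_def of_nat_sum[symmetric] of_nat_le_iff .
  qed (auto simp: F_def intro!: max_colorable_integrable cube Q)
  also have "\<dots> = (\<Sum>j\<in>J. \<integral>\<omega>. real (max_colorable k 1 (Q j \<inter> X \<omega>)) \<partial>M)"
    by (intro Bochner_Integration.integral_sum max_colorable_integrable Q)
  also have "\<dots> = (\<Sum>j\<in>J. \<integral>\<omega>. real (F X k t \<omega>) \<partial>M)"
    unfolding Q_def F_def by (intro sum.cong refl max_colorable_integral_translation cube)
  finally show ?thesis
    by (simp add: J(2))
qed

lemma F_bar_le:
  assumes "0 < lam" "0 < t" "0 < s"
  shows "F_bar M X k lam s \<le> (1 + t / s) ^ CARD('d) * F_bar M X k lam t"
proof -
  \<comment> \<open>The least number of translates per axis allowed by the strict inequality in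
    \<open>cube_cover\<close>; it exceeds \<open>s / t\<close> by at most one, which yields the
    factor \<open>1 + t / s\<close>.\<close>
  define n where "n = nat \<lfloor>s / t\<rfloor> + 1"
  have "s / t < real n" "real n \<le> s / t + 1"
    unfolding n_def using assms by (auto intro: divide_nonneg_nonneg) linarith
  then have n: "s < real n * t" "real n * t / s \<le> 1 + t / s"
    using assms by (auto simp: field_simps)
  have bar: "F_bar M X k lam u = (\<integral>\<omega>. real (F X k u \<omega>) \<partial>M) / (lam * u ^ CARD('d))" for u
    unfolding F_bar_def F_tilde_def by simp
  have nonneg: "0 \<le> F_bar M X k lam t"
    unfolding bar using assms by (intro divide_nonneg_nonneg integral_nonneg) auto
  have "F_bar M X k lam s \<le> real n ^ CARD('d) * (\<integral>\<omega>. real (F X k t \<omega>) \<partial>M) / (lam * s ^ CARD('d))"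
    unfolding bar using assms integral_F_le[OF assms(2) n(1)] by (intro divide_right_mono) auto
  \<comment> \<open>Passing from the normalisation \<open>lam * s ^ CARD('d)\<close> to
    \<open>lam * t ^ CARD('d)\<close> costs \<open>(t / s) ^ CARD('d)\<close>, which merges with the
    number of translates.\<close>
  also have "\<dots> = (real n * t / s) ^ CARD('d) * F_bar M X k lam t"
    unfolding bar using assms by (simp add: power_mult_distrib power_divide)
  also have "\<dots> \<le> (1 + t / s) ^ CARD('d) * F_bar M X k lam t"
    using n(2) nonneg assms by (intro mult_right_mono power_mono) auto
  finally show ?thesis .
qed

end

section \<open>Convergence to the infimum\<close>

theorem proposition1:
  fixes M :: "'w measure" and X :: "'w \<Rightarrow> (real ^ 'd) set" and k :: nat and lam :: real
  assumes "k \<ge> 1" and "lam > 0" and "poisson_process M X lam"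
  shows "((\<lambda>t. F_bar M X k lam t) \<longlongrightarrow> a_const M X k lam) at_top"
proof -
  interpret poisson_process M X lam
    by fact
  have nonneg: "0 \<le> F_bar M X k lam t" if "0 < t" for t
    unfolding F_bar_def F_tilde_def using assms(2) that by (intro integral_nonneg_AE AE_I2) simp
  \<comment> \<open>The infimum of reals is a genuine lower bound only for a set bounded below; 0
    serves as the bound.\<close>
  have bdd: "bdd_below (F_bar M X k lam ` {0<..})"
    using nonneg by (intro bdd_belowI[of _ 0]) auto
  show ?thesis
  proof (rule order_tendstoI)
    fix b assume b: "b < a_const M X k lam"
    show "\<forall>\<^sub>F s in at_top. b < F_bar M X k lam s"
      using eventually_gt_at_top[of 0]
    proof (rule eventually_mono)
      fix s :: real assume "0 < s"
      then have "a_const M X k lam \<le> F_bar M X k lam s"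
        unfolding a_const_def by (intro cINF_lower[OF bdd]) simp
      with b show "b < F_bar M X k lam s"
        by simp
    qed
  next
    fix b assume "a_const M X k lam < b"
    \<comment> \<open>This \<open>t\<close> stays fixed while \<open>s\<close> grows: the bound from
      \<open>F_bar_le\<close> tends to the value at \<open>t\<close>, which is already below
      \<open>b\<close>.\<close>
    then obtain t where t: "0 < t" "F_bar M X k lam t < b"
      unfolding a_const_def by (auto simp: cINF_less_iff[OF _ bdd])
    have "((\<lambda>s. t / s) \<longlongrightarrow> 0) at_top"
      by (rule tendsto_divide_0[OF tendsto_const]) (rule filterlim_at_top_imp_at_infinity[OF filterlim_ident])
    then have "((\<lambda>s. (1 + t / s) ^ CARD('d) * F_bar M X k lam t)
        \<longlongrightarrow> (1 + 0) ^ CARD('d) * F_bar M X k lam t) at_top"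
      by (intro tendsto_intros)
    then have "\<forall>\<^sub>F s in at_top. (1 + t / s) ^ CARD('d) * F_bar M X k lam t < b"
      using t(2) by (intro order_tendstoD(2)) auto
    then show "\<forall>\<^sub>F s in at_top. F_bar M X k lam s < b"
      using eventually_gt_at_top[of 0]
      by eventually_elim (use F_bar_le[OF assms(2) t(1)] in \<open>auto intro: le_less_trans\<close>)
  qed
qed

end
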